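(* Let $ABC$ be a triangle in the projective plane and let $P$ be a point not lying on any of the lines $BC, CA, AB$. Let $A_1, B_1, C_1$ be arbitrary points on the lines $AP, BP, CP$ respectively. Let $Q$ be an arbitrary point not lying on any of the lines $BC, CA, AB$. Let $A_Q = QA_1\cap BC$, $B_Q = QB_1\cap AC$, $C_Q = QC_1\cap AB$, and let $$V_C = A_QB_1\cap B_QA_1,\qquad V_A = B_QC_1\cap C_QB_1,\qquad V_B = A_QC_1\cap C_QA_1.$$ Then the lines $AV_A$, $BV_B$, $CV_C$ pass through one point.
   Context: Everything takes place in the (real) projective plane. A triangle is a triple of non-collinear points; its sides are full lines. For distinct points $X,Y$, $XY$ denotes the line through them. The arbitrary choices are assumed to be such that all the named objects are well defined: each line $XY$ that is mentioned joins two distinct points, and each intersection point that is named is the intersection of two distinct lines. *)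

theory Defs
  imports "HOL-Analysis.Analysis"
begin

text \<open>
  The real projective plane: points are the one-dimensional linear subspaces of
  \<open>real ^ 3\<close>, and a line is the set of all points contained in a fixed
  two-dimensional linear subspace.
\<close>

typedef proj_point = "{S :: (real ^ 3) set. subspace S \<and> dim S = 1}"
  morphisms subspace_of Abs_proj_point
proof -
  have "subspace (span {axis 1 1 :: real ^ 3}) \<and> dim (span {axis 1 1 :: real ^ 3}) = 1"
    by (simp add: dim_singleton axis_eq_0_iff)
  then show ?thesis by blast
qed

definition is_proj_line :: "proj_point set \<Rightarrow> bool" where
  "is_proj_line L \<longleftrightarrow>
     (\<exists>W. subspace W \<and> dim W = 2 \<and> L = {X. subspace_of X \<subseteq> W})"

text \<open>
  This is a line only if \<open>X \<noteq> Y\<close>; it is then the unique line through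
  \<open>X\<close> and \<open>Y\<close>, see \<open>line_through_unique\<close> below.
\<close>

definition line_through :: "proj_point \<Rightarrow> proj_point \<Rightarrow> proj_point set" where
  "line_through X Y = {Z. subspace_of Z \<subseteq> span (subspace_of X \<union> subspace_of Y)}"

definition proj_triangle :: "proj_point \<Rightarrow> proj_point \<Rightarrow> proj_point \<Rightarrow> bool" where
  "proj_triangle A B C \<longleftrightarrow> \<not> (\<exists>L. is_proj_line L \<and> A \<in> L \<and> B \<in> L \<and> C \<in> L)"

lemma subspace_subspace_of: "subspace (subspace_of X)"
  and dim_subspace_of: "dim (subspace_of X) = 1"
  using subspace_of[of X] by auto

lemma dim_join:
  assumes "X \<noteq> Y"
  shows "dim (span (subspace_of X \<union> subspace_of Y)) = 2"
proof -
  let ?S = "subspace_of X" and ?T = "subspace_of Y"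
  have ne: "?S \<noteq> ?T" using assms by (simp add: subspace_of_inject)
  have sI: "subspace (?S \<inter> ?T)" by (simp add: subspace_inter subspace_subspace_of)
  have "dim (?S \<inter> ?T) = 0"
  proof (rule ccontr)
    assume "dim (?S \<inter> ?T) \<noteq> 0"
    then have "dim (?S \<inter> ?T) \<ge> 1" by linarith
    then have "dim ?S \<le> dim (?S \<inter> ?T)" "dim ?T \<le> dim (?S \<inter> ?T)"
      by (simp_all only: dim_subspace_of)
    then have "?S \<inter> ?T = ?S" "?S \<inter> ?T = ?T"
      by (simp_all only: subspace_dim_equal[OF sI subspace_subspace_of] Int_lower1 Int_lower2)
    with ne show False by simp
  qed
  moreover have "dim {x + y |x y. x \<in> ?S \<and> y \<in> ?T} + dim (?S \<inter> ?T) = dim ?S + dim ?T"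
    by (rule dim_sums_Int[OF subspace_subspace_of subspace_subspace_of])
  moreover have "span (?S \<union> ?T) = {x + y |x y. x \<in> ?S \<and> y \<in> ?T}"
    using span_Un[of ?S ?T] by (simp add: span_eq_iff[THEN iffD2, OF subspace_subspace_of])
  ultimately show ?thesis by (simp only: dim_subspace_of)
qed

lemma line_through_unique:
  assumes "X \<noteq> Y"
  shows "is_proj_line L \<and> X \<in> L \<and> Y \<in> L \<longleftrightarrow> L = line_through X Y"
proof
  assume "is_proj_line L \<and> X \<in> L \<and> Y \<in> L"
  then obtain W where W: "subspace W" "dim W = 2" "L = {X. subspace_of X \<subseteq> W}"
    and XY: "subspace_of X \<union> subspace_of Y \<subseteq> W"
    unfolding is_proj_line_def by auto
  have "span (subspace_of X \<union> subspace_of Y) = W"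
    using subspace_dim_equal[OF subspace_span W(1) span_minimal[OF XY W(1)]]
      dim_join[OF assms] W(2) by simp
  then show "L = line_through X Y" using W(3) by (simp add: line_through_def)
next
  assume "L = line_through X Y"
  moreover have "is_proj_line (line_through X Y)"
    unfolding is_proj_line_def line_through_def
    by (intro exI[of _ "span (subspace_of X \<union> subspace_of Y)"])
      (simp only: dim_join[OF assms] subspace_span simp_thms)
  moreover have "X \<in> line_through X Y" "Y \<in> line_through X Y"
    using span_superset[of "subspace_of X \<union> subspace_of Y"]
    by (simp_all add: line_through_def)
  ultimately show "is_proj_line L \<and> X \<in> L \<and> Y \<in> L" by simp
qed

text \<open>
  Hence, for lines \<open>L\<close> and \<open>M\<close>, the equation \<open>L \<inter> M = {Z}\<close> holds exactly if
  \<open>L \<noteq> M\<close> and \<open>Z\<close> is their point of intersection; a line has more than one point.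
\<close>

lemma two_lines_meet:
  assumes "is_proj_line L" "is_proj_line M" "L \<noteq> M"
  shows "\<exists>!Z. Z \<in> L \<inter> M"
proof -
  obtain U where U: "subspace U" "dim U = 2" "L = {X. subspace_of X \<subseteq> U}"
    using assms(1) unfolding is_proj_line_def by auto
  obtain W where W: "subspace W" "dim W = 2" "M = {X. subspace_of X \<subseteq> W}"
    using assms(2) unfolding is_proj_line_def by auto
  have sI: "subspace (U \<inter> W)" by (simp add: subspace_inter U W)
  have "dim {x + y |x y. x \<in> U \<and> y \<in> W} \<le> 3"
    using dim_subset_UNIV[of "{x + y |x y. x \<in> U \<and> y \<in> W}"] by simp
  with dim_sums_Int[OF U(1) W(1)] U(2) W(2) have "dim (U \<inter> W) \<ge> 1" by simp
  then have "\<not> U \<inter> W \<subseteq> {0}" by (simp flip: dim_eq_0)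
  then obtain x where x: "x \<in> U \<inter> W" "x \<noteq> 0" by blast
  define Z where "Z = Abs_proj_point (span {x})"
  have Z: "subspace_of Z = span {x}"
    unfolding Z_def using x by (subst Abs_proj_point_inverse) (auto simp: dim_singleton)
  have ZLM: "Z \<in> L \<inter> M"
    using Z x sI U(3) W(3) span_minimal[of "{x}" "U \<inter> W"] by auto
  have "Z' = Z" if Z': "Z' \<in> L \<inter> M" for Z'
  proof (rule ccontr)
    assume ne: "Z' \<noteq> Z"
    have "L = line_through Z' Z" "M = line_through Z' Z"
      using line_through_unique[OF ne, of L] line_through_unique[OF ne, of M] assms(1,2) Z' ZLM
      by simp_all
    with assms(3) show False by simp
  qed
  with ZLM show ?thesis by blast
qed

end

theory Submission
  imports Defs
begin

text \<open>
  Three vectors spanning \<open>A\<close>, \<open>B\<close>, \<open>C\<close> form a basis of the space, and since \<open>P\<close> lies off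
  the sides they can be rescaled so that their sum spans \<open>P\<close> (\<open>projective_frame\<close>). In
  the homogeneous coordinates of this basis \<open>P = (1,1,1)\<close>, so the choices of points on
  \<open>AP\<close>, \<open>BP\<close>, \<open>CP\<close> read \<open>A1 = (x,s,s)\<close>, \<open>B1 = (t,y,t)\<close>, \<open>C1 = (u,u,z)\<close>, and
  \<open>Q = (p,q,r)\<close> has no vanishing coordinate. Joins and meets are cross products, and
  computing \<open>V_C\<close> as an iterated cross product shows that its first two coordinates
  are \<open>x t q\<close> and \<open>y s p\<close> multiplied by the same polynomial \<open>D\<close>
  (\<open>crossing_point_coords\<close>). If none of the parameters vanishes, the line \<open>CV_C\<close>
  therefore prescribes the ratio of the first two coordinates to be \<open>(x/s)/p : (y/t)/q\<close>.

  Rotating the basis vectors turns this into the analogous statements for \<open>V_A\<close> and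
  \<open>V_B\<close>. All three ratios are visibly those of a single point,
  \<open>X = ((x/s)/p, (y/t)/q, (z/u)/r)\<close>, which is therefore the common point of the lines.
  Since \<open>s\<close>, \<open>t\<close>, \<open>u\<close> may vanish, the denominators are cleared; the resulting vector is
  nonzero because \<open>V_A \<noteq> A\<close>, \<open>V_B \<noteq> B\<close>, \<open>V_C \<noteq> C\<close> prevent
  both terms of any of the three ratios from vanishing together.
\<close>

section \<open>Vectors in three-dimensional space\<close>

unbundle cross3_syntax

lemma vec3_eq_iff: "v = w \<longleftrightarrow> v$1 = w$1 \<and> v$2 = w$2 \<and> v$3 = w$3" for v w :: "real^3"
  by (simp add: vec_eq_iff forall_3)

lemma vector3_eta: "vector [v$1, v$2, v$3] = v" for v :: "real^3"
  by (simp add: vec3_eq_iff)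

lemma minus_vector3: "- vector [x, y, z] = (vector [- x, - y, - z] :: real^3)"
  by (simp add: vec3_eq_iff)

lemma cross_eq_0_imp_scaled:
  fixes v w :: "real^3"
  assumes "v \<times> w = 0" "v \<noteq> 0"
  shows "\<exists>k. w = k *\<^sub>R v"
proof -
  have "(v \<bullet> v) *\<^sub>R w = (v \<bullet> w) *\<^sub>R v"
    using Lagrange[of v v w] assms(1) by simp
  then have "w = ((v \<bullet> w) / (v \<bullet> v)) *\<^sub>R v"
    using assms(2) by (metis divide_inverse_commute inner_eq_zero_iff left_inverse scaleR_one scaleR_scaleR)
  then show ?thesis by blast
qed

text \<open>
  With \<open>n = v \<times> w\<close>, the triple product identity gives \<open>n \<times> (z \<times> n) = |n|\<^sup>2 z\<close> for \<open>z\<close>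
  orthogonal to \<open>n\<close>, while \<open>n \<times> y\<close> is a combination of \<open>v\<close> and \<open>w\<close> for every \<open>y\<close>.
\<close>

lemma in_span_iff_triple_eq_0:
  fixes v w z :: "real^3"
  assumes "v \<times> w \<noteq> 0"
  shows "z \<in> span {v, w} \<longleftrightarrow> (v \<times> w) \<bullet> z = 0"
proof
  assume "z \<in> span {v, w}"
  then obtain k l where "z = k *\<^sub>R v + l *\<^sub>R w"
    by (auto simp: span_insert span_singleton) (metis add.commute diff_add_cancel)
  then show "(v \<times> w) \<bullet> z = 0" by (simp add: inner_add_right dot_cross_self)
next
  assume orth: "(v \<times> w) \<bullet> z = 0"
  define n where "n = v \<times> w"
  have "(n \<bullet> n) *\<^sub>R z = n \<times> (z \<times> n)"
    using orth by (simp add: Lagrange[of n z n]) (simp add: n_def)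
  also have "\<dots> = (v \<bullet> (z \<times> n)) *\<^sub>R w - (w \<bullet> (z \<times> n)) *\<^sub>R v"
    by (simp add: n_def vec3_eq_iff cross3_simps)
  also have "\<dots> \<in> span {v, w}"
    by (intro span_diff span_scale span_base) simp_all
  finally have "inverse (n \<bullet> n) *\<^sub>R ((n \<bullet> n) *\<^sub>R z) \<in> span {v, w}" by (rule span_scale)
  moreover have "n \<bullet> n \<noteq> 0" using assms by (simp add: n_def)
  ultimately show "z \<in> span {v, w}" by simp
qed

section \<open>Homogeneous coordinates\<close>

definition frame :: "real^3 \<Rightarrow> real^3 \<Rightarrow> real^3 \<Rightarrow> real^3 \<Rightarrow> real^3" where
  "frame a b c v = v$1 *\<^sub>R a + v$2 *\<^sub>R b + v$3 *\<^sub>R c"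

text \<open>
  The coordinates of a point are only determined up to a nonzero factor, hence a
  relation rather than a function.
\<close>

definition coords :: "real^3 \<Rightarrow> real^3 \<Rightarrow> real^3 \<Rightarrow> proj_point \<Rightarrow> real^3 \<Rightarrow> bool" where
  "coords a b c X v \<longleftrightarrow> v \<noteq> 0 \<and> frame a b c v \<in> subspace_of X"

definition basis3 :: "real^3 \<Rightarrow> real^3 \<Rightarrow> real^3 \<Rightarrow> bool" where
  "basis3 a b c \<longleftrightarrow> (a \<times> b) \<bullet> c \<noteq> 0"

text \<open>
  Cyclic rotation of the basis is what carries a fact about the vertex \<open>C\<close> over to
  \<open>A\<close> and \<open>B\<close>.
\<close>

lemma basis3_rotate: "basis3 a b c \<Longrightarrow> basis3 b c a"
  by (simp add: basis3_def cross_triple[of a b c])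

lemma coords_rotate: "coords a b c X (vector [x, y, z]) \<Longrightarrow> coords b c a X (vector [y, z, x])"
  by (auto simp: coords_def frame_def vec3_eq_iff add_ac)

lemma linear_frame: "linear (frame a b c)"
  by (rule linearI) (simp_all add: frame_def algebra_simps)

text \<open>
  By Cramer's rule, pairing a combination of \<open>a\<close>, \<open>b\<close>, \<open>c\<close> with the cross product of
  two of them isolates the coefficient of the third.
\<close>

lemma bij_frame:
  assumes "basis3 a b c"
  shows "bij (frame a b c)"
proof -
  have "v = 0" if v: "frame a b c v = 0" for v
  proof -
    have "(b \<times> c) \<bullet> frame a b c v = v$1 * ((a \<times> b) \<bullet> c)"
      "(c \<times> a) \<bullet> frame a b c v = v$2 * ((a \<times> b) \<bullet> c)"
      "(a \<times> b) \<bullet> frame a b c v = v$3 * ((a \<times> b) \<bullet> c)"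
      by (simp_all add: frame_def cross3_simps)
    then show "v = 0"
      using assms unfolding v basis3_def vec3_eq_iff by simp
  qed
  then have "inj (frame a b c)"
    using linear_injective_0[OF linear_frame] by blast
  then show ?thesis
    using linear_injective_imp_surjective[OF linear_frame] by (simp add: bij_def)
qed

lemma subspace_of_eq_span:
  assumes "x \<in> subspace_of X" "x \<noteq> 0"
  shows "subspace_of X = span {x}"
  using assms subspace_dim_equal[of "span {x}" "subspace_of X"]
  by (simp add: span_minimal subspace_subspace_of dim_subspace_of dim_singleton)

lemma subspace_of_nonzero: "\<exists>x \<in> subspace_of X. x \<noteq> 0"
proof -
  have "\<not> subspace_of X \<subseteq> {0}"
    using dim_subspace_of[of X] by (simp flip: dim_eq_0)
  then show ?thesis by blast
qed

lemma point_of_nonzero: "x \<noteq> 0 \<Longrightarrow> \<exists>X. x \<in> subspace_of X"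
  by (rule exI[of _ "Abs_proj_point (span {x})"])
    (simp add: Abs_proj_point_inverse dim_singleton span_base)

lemma frame_eq_0_iff: "basis3 a b c \<Longrightarrow> frame a b c v = 0 \<longleftrightarrow> v = 0"
  using bij_frame[of a b c] linear_frame[of a b c]
  by (metis bij_is_inj injD linear_0)

lemma coords_span:
  assumes "basis3 a b c" "coords a b c X v"
  shows "subspace_of X = frame a b c ` span {v}"
  using assms subspace_of_eq_span[of "frame a b c v" X] linear_span_image[OF linear_frame, of a b c "{v}"]
  by (simp add: coords_def frame_eq_0_iff)

lemma coords_scale:
  assumes "coords a b c X (k *\<^sub>R v)"
  shows "coords a b c X v"
proof -
  have "k \<noteq> 0" "v \<noteq> 0" using assms by (auto simp: coords_def)
  have "frame a b c v = inverse k *\<^sub>R frame a b c (k *\<^sub>R v)"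
    using \<open>k \<noteq> 0\<close> by (simp add: frame_def scaleR_add_right mult.assoc[symmetric])
  also have "\<dots> \<in> subspace_of X"
    using assms by (simp add: coords_def subspace_scale subspace_subspace_of)
  finally show ?thesis using \<open>v \<noteq> 0\<close> by (simp add: coords_def)
qed

lemma coords_exist:
  assumes "basis3 a b c"
  shows "\<exists>v. coords a b c X v"
proof -
  obtain x where x: "x \<in> subspace_of X" "x \<noteq> 0" using subspace_of_nonzero by blast
  obtain v where "x = frame a b c v"
    using bij_is_surj[OF bij_frame[OF assms]] by (metis surjD)
  with x frame_eq_0_iff[OF assms] show ?thesis by (auto simp: coords_def)
qed

lemma point_with_coords:
  assumes "basis3 a b c" "v \<noteq> 0"
  shows "\<exists>X. coords a b c X v"
  using point_of_nonzero[of "frame a b c v"] assms by (auto simp: coords_def frame_eq_0_iff)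

text \<open>
  The coordinates turn the incidence relations into equations: two points coincide if
  their coordinates are proportional, and \<open>v \<times> w\<close> is the coordinate vector of the line
  joining distinct points.
\<close>

lemma coords_eq_iff:
  assumes F: "basis3 a b c" and "coords a b c X v" "coords a b c Y w"
  shows "X = Y \<longleftrightarrow> v \<times> w = 0"
proof
  assume "X = Y"
  then have "frame a b c w \<in> frame a b c ` span {v}"
    using assms(3) coords_span[OF F assms(2)] by (simp add: coords_def)
  then have "w \<in> span {v}" using bij_is_inj[OF bij_frame[OF F]] by (simp add: inj_image_mem_iff)
  then show "v \<times> w = 0" by (auto simp: span_singleton cross_mult_right)
next
  assume "v \<times> w = 0"
  moreover have "v \<noteq> 0" "w \<noteq> 0" using assms by (simp_all add: coords_def)
  ultimately obtain k where "w = k *\<^sub>R v" "k \<noteq> 0"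
    using cross_eq_0_imp_scaled[of v w] by auto
  then have "span {w} = span {v}"
    using span_image_scale[of "{v}" "\<lambda>_. k"] by simp
  then have "subspace_of X = subspace_of Y"
    using coords_span[OF F assms(2)] coords_span[OF F assms(3)] by simp
  then show "X = Y" by (simp add: subspace_of_inject)
qed

lemma in_line_iff:
  assumes F: "basis3 a b c"
    and X: "coords a b c X v" and Y: "coords a b c Y w" and Z: "coords a b c Z z"
    and ne: "X \<noteq> Y"
  shows "Z \<in> line_through X Y \<longleftrightarrow> (v \<times> w) \<bullet> z = 0"
proof -
  have "span (subspace_of X \<union> subspace_of Y) = frame a b c ` span (span {v} \<union> span {w})"
    using coords_span[OF F X] coords_span[OF F Y]
    by (simp add: image_Un[symmetric] linear_span_image[OF linear_frame])
  also have "span (span {v} \<union> span {w}) = span {v, w}"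
    using span_Un[of "span {v}" "span {w}"] span_Un[of "{v}" "{w}"]
    by (simp add: span_span insert_is_Un[of v "{w}"])
  finally have "span (subspace_of X \<union> subspace_of Y) = frame a b c ` span {v, w}" .
  moreover have "subspace_of Z = frame a b c ` span {z}" by (rule coords_span[OF F Z])
  ultimately have "Z \<in> line_through X Y \<longleftrightarrow> span {z} \<subseteq> span {v, w}"
    using bij_is_inj[OF bij_frame[OF F]] by (simp add: line_through_def inj_image_subset_iff)
  also have "\<dots> \<longleftrightarrow> z \<in> span {v, w}"
    by (meson empty_subsetI insert_subset span_base span_minimal subset_iff singletonI subspace_span)
  also have "\<dots> \<longleftrightarrow> (v \<times> w) \<bullet> z = 0"
    using in_span_iff_triple_eq_0 coords_eq_iff[OF F X Y] ne by blast
  finally show ?thesis .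
qed

lemma points_in_line: "X \<in> line_through X Y" "Y \<in> line_through X Y"
  using span_superset[of "subspace_of X \<union> subspace_of Y"] by (simp_all add: line_through_def)

text \<open>
  Both lines have a normal vector, and a vector orthogonal to both normals is their
  cross product. It does not vanish: proportional normals would describe the same line,
  and a line has more than the one point \<open>Z\<close>.
\<close>

lemma meeting_point_coords:
  assumes F: "basis3 a b c"
    and X: "coords a b c X v" and Y: "coords a b c Y w"
    and X': "coords a b c X' v'" and Y': "coords a b c Y' w'"
    and ne: "X \<noteq> Y" "X' \<noteq> Y'"
    and meet: "line_through X Y \<inter> line_through X' Y' = {Z}"
  shows "coords a b c Z ((v \<times> w) \<times> (v' \<times> w'))"
proof -
  define m n where "m = v \<times> w" and "n = v' \<times> w'"
  have nz: "m \<noteq> 0" "n \<noteq> 0"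
    using coords_eq_iff[OF F X Y] coords_eq_iff[OF F X' Y'] ne by (simp_all add: m_def n_def)
  have lines: "U \<in> line_through X Y \<longleftrightarrow> m \<bullet> u = 0" "U \<in> line_through X' Y' \<longleftrightarrow> n \<bullet> u = 0"
    if "coords a b c U u" for U u
    using in_line_iff[OF F X Y that ne(1)] in_line_iff[OF F X' Y' that ne(2)]
    by (simp_all add: m_def n_def)
  have "m \<times> n \<noteq> 0"
  proof
    assume "m \<times> n = 0"
    then obtain k where k: "n = k *\<^sub>R m"
      using cross_eq_0_imp_scaled nz(1) by blast
    have "U \<in> line_through X' Y'" if "U \<in> line_through X Y" for U
      using coords_exist[OF F, of U] lines that k by auto
    then have "X \<in> {Z}" "Y \<in> {Z}" using points_in_line[of X Y] points_in_line[of Y X] meet by blast+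
    with ne(1) show False by simp
  qed
  then obtain U where U: "coords a b c U (m \<times> n)" using point_with_coords[OF F] by blast
  then have "U \<in> {Z}"
    using lines[OF U] unfolding meet[symmetric] by (simp add: dot_cross_self)
  with U show ?thesis by (simp add: m_def n_def)
qed

section \<open>The frame of a triangle and a point\<close>

text \<open>
  If \<open>a\<close>, \<open>b\<close>, \<open>c\<close> were dependent, a common normal \<open>n\<close> would exist, and its orthogonal
  plane would be a line through \<open>A\<close>, \<open>B\<close>, \<open>C\<close>. Working with \<open>n\<close> rather than with the
  span of the three vectors covers the case of coinciding points, where that span is too small.
\<close>

lemma triangle_basis3:
  assumes "proj_triangle A B C"
    and "a \<in> subspace_of A" "a \<noteq> 0" "b \<in> subspace_of B" "b \<noteq> 0" "c \<in> subspace_of C" "c \<noteq> 0"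
  shows "basis3 a b c"
proof (rule ccontr)
  assume "\<not> basis3 a b c"
  then have "det (vector [a, b, c] :: real^3^3) = 0"
    by (simp add: basis3_def cross_triple[of a b c] inner_commute[of a] flip: dot_cross_det)
  then obtain n where n: "n \<noteq> 0" "(vector [a, b, c] :: real^3^3) *v n = 0"
    by (metis invertible_det_nz invertible_left_inverse matrix_left_invertible_ker)
  then have orth: "n \<bullet> a = 0" "n \<bullet> b = 0" "n \<bullet> c = 0"
    by (simp_all add: vec3_eq_iff matrix_vector_mul_component inner_commute[of n])
  define W where "W = {x. n \<bullet> x = 0}"
  have "subspace W" "dim W = 2"
    using n(1) by (simp_all add: W_def subspace_hyperplane dim_hyperplane)
  then have "is_proj_line {X. subspace_of X \<subseteq> W}" by (auto simp: is_proj_line_def)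
  moreover have "span {x} \<subseteq> W" if "n \<bullet> x = 0" for x
    using that \<open>subspace W\<close> by (intro span_minimal) (auto simp: W_def)
  then have "subspace_of A \<subseteq> W" "subspace_of B \<subseteq> W" "subspace_of C \<subseteq> W"
    using orth assms subspace_of_eq_span by metis+
  ultimately show False using assms(1) by (auto simp: proj_triangle_def)
qed

text \<open>
  A coordinate of \<open>P\<close> vanishes exactly if \<open>P\<close> lies on the corresponding side, so the
  three coordinates can be absorbed into the basis vectors.
\<close>

lemma projective_frame:
  assumes T: "proj_triangle A B C"
    and P: "P \<notin> line_through B C" "P \<notin> line_through C A" "P \<notin> line_through A B"
  shows "\<exists>a b c. basis3 a b c \<and> coords a b c A (vector [1,0,0]) \<and> coords a b c B (vector [0,1,0])
    \<and> coords a b c C (vector [0,0,1]) \<and> coords a b c P (vector [1,1,1])"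
proof -
  obtain a b c where abc: "a \<in> subspace_of A" "a \<noteq> 0" "b \<in> subspace_of B" "b \<noteq> 0"
      "c \<in> subspace_of C" "c \<noteq> 0"
    using subspace_of_nonzero by metis
  then have F: "basis3 a b c" by (rule triangle_basis3[OF T])
  have A: "coords a b c A (vector [1,0,0])" and B: "coords a b c B (vector [0,1,0])"
    and C: "coords a b c C (vector [0,0,1])"
    using abc by (simp_all add: coords_def frame_def vec3_eq_iff)
  obtain p where p: "coords a b c P p" using coords_exist[OF F] by blast
  have ne: "B \<noteq> C" "C \<noteq> A" "A \<noteq> B"
    using coords_eq_iff[OF F B C] coords_eq_iff[OF F C A] coords_eq_iff[OF F A B]
    by (simp_all add: vec3_eq_iff cross_components)
  have p0: "p$1 \<noteq> 0" "p$2 \<noteq> 0" "p$3 \<noteq> 0"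
    using P in_line_iff[OF F B C p ne(1)] in_line_iff[OF F C A p ne(2)] in_line_iff[OF F A B p ne(3)]
    by (simp_all add: cross3_simps)
  define a' b' c' where "a' = p$1 *\<^sub>R a" and "b' = p$2 *\<^sub>R b" and "c' = p$3 *\<^sub>R c"
  have abc': "a' \<in> subspace_of A" "a' \<noteq> 0" "b' \<in> subspace_of B" "b' \<noteq> 0"
      "c' \<in> subspace_of C" "c' \<noteq> 0"
    using abc p0 by (simp_all add: a'_def b'_def c'_def subspace_scale subspace_subspace_of)
  have "coords a' b' c' P (vector [1,1,1])"
    using p by (simp add: coords_def frame_def vec3_eq_iff a'_def b'_def c'_def)
  moreover have "basis3 a' b' c'" using abc' by (rule triangle_basis3[OF T])
  ultimately show ?thesis
    using abc' by (intro exI[of _ a'] exI[of _ b'] exI[of _ c'])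
      (simp add: coords_def frame_def vec3_eq_iff)
qed

section \<open>The crossing points and their common point\<close>

text \<open>
  Expanding \<open>(A_Q \<times> B1) \<times> (B_Q \<times> A1)\<close> gives \<open>(D x t q, D y s p, d)\<close> for some \<open>d\<close>. The
  line joining \<open>V\<close> to \<open>C = (0,0,1)\<close> depends only on the ratio of the first two
  coordinates, so \<open>d\<close> is left unspecified. If \<open>D\<close>, or both \<open>x t\<close> and \<open>y s\<close>, were zero, then \<open>V\<close>
  would be \<open>C\<close>.
\<close>

lemma crossing_point_coords:
  assumes F: "basis3 a b c"
    and A: "coords a b c A (vector [1,0,0])" and B: "coords a b c B (vector [0,1,0])"
    and C: "coords a b c C (vector [0,0,1])"
    and A1: "coords a b c A1 (vector [x,s,s])" and B1: "coords a b c B1 (vector [t,y,t])"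
    and Q: "coords a b c Q (vector [p,q,r])"
    and Q_ne: "Q \<noteq> A1" "Q \<noteq> B1"
    and A_Q: "line_through Q A1 \<inter> line_through B C = {A_Q}"
    and B_Q: "line_through Q B1 \<inter> line_through A C = {B_Q}"
    and ne: "A_Q \<noteq> B1" "B_Q \<noteq> A1"
    and V: "line_through A_Q B1 \<inter> line_through B_Q A1 = {V}"
    and CV: "C \<noteq> V"
  shows "\<exists>d. coords a b c V (vector [x * t * q, y * s * p, d])" "x * t \<noteq> 0 \<or> y * s \<noteq> 0"
proof -
  have "B \<noteq> C" "A \<noteq> C"
    using coords_eq_iff[OF F B C] coords_eq_iff[OF F A C]
    by (simp_all add: vec3_eq_iff cross_components)
  have A_Q': "coords a b c A_Q (vector [0, x * q - p * s, x * r - p * s])"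
    \<comment> \<open>The cross product formula yields the negative of this vector.\<close>
    by (rule coords_scale[of _ _ _ _ "-1"])
      (use meeting_point_coords[OF F Q A1 B C Q_ne(1) \<open>B \<noteq> C\<close> A_Q] in
        \<open>simp add: cross3_def algebra_simps minus_vector3\<close>)
  have B_Q': "coords a b c B_Q (vector [y * p - q * t, 0, y * r - q * t])"
    using meeting_point_coords[OF F Q B1 A C Q_ne(2) \<open>A \<noteq> C\<close> B_Q]
    by (simp add: cross3_def algebra_simps)
  \<comment> \<open>The common factor left over in the first two coordinates of \<open>V\<close>.\<close>
  define D where "D = x * y * r - x * t * q - y * s * p + s * t * (p + q - r)"
  obtain d where V': "coords a b c V (vector [D * (x * t * q), D * (y * s * p), d])"
    using meeting_point_coords[OF F A_Q' B1 B_Q' A1 ne V]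
    by (simp add: cross3_def D_def algebra_simps)
  have "D \<noteq> 0 \<and> (x * t * q \<noteq> 0 \<or> y * s * p \<noteq> 0)"
    using CV coords_eq_iff[OF F C V'] by (auto simp: vec3_eq_iff cross_components)
  moreover from this have "vector [D * (x * t * q), D * (y * s * p), d]
    = D *\<^sub>R (vector [x * t * q, y * s * p, d/D] :: real^3)"
    by (simp add: vec3_eq_iff)
  ultimately show "\<exists>d. coords a b c V (vector [x * t * q, y * s * p, d])" "x * t \<noteq> 0 \<or> y * s \<noteq> 0"
    using V' coords_scale[of a b c V D] by auto
qed

theorem theorem1p6:
  fixes A B C P A1 B1 C1 Q A_Q B_Q C_Q V_A V_B V_C :: proj_point
  assumes triangle: "proj_triangle A B C"
    and P: "P \<notin> line_through B C" "P \<notin> line_through C A" "P \<notin> line_through A B"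
    and A1: "A1 \<in> line_through A P"
    and B1: "B1 \<in> line_through B P"
    and C1: "C1 \<in> line_through C P"
    and Q: "Q \<notin> line_through B C" "Q \<notin> line_through C A" "Q \<notin> line_through A B"
    and Q_lines: "Q \<noteq> A1" "Q \<noteq> B1" "Q \<noteq> C1"
    and A_Q: "line_through Q A1 \<inter> line_through B C = {A_Q}"
    and B_Q: "line_through Q B1 \<inter> line_through A C = {B_Q}"
    and C_Q: "line_through Q C1 \<inter> line_through A B = {C_Q}"
    and V_C_lines: "A_Q \<noteq> B1" "B_Q \<noteq> A1"
    and V_A_lines: "B_Q \<noteq> C1" "C_Q \<noteq> B1"
    and V_B_lines: "A_Q \<noteq> C1" "C_Q \<noteq> A1"
    and V_C: "line_through A_Q B1 \<inter> line_through B_Q A1 = {V_C}"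
    and V_A: "line_through B_Q C1 \<inter> line_through C_Q B1 = {V_A}"
    and V_B: "line_through A_Q C1 \<inter> line_through C_Q A1 = {V_B}"
    and V_lines: "A \<noteq> V_A" "B \<noteq> V_B" "C \<noteq> V_C"
  shows "\<exists>X. X \<in> line_through A V_A \<and> X \<in> line_through B V_B \<and> X \<in> line_through C V_C"
proof -
  obtain a b c where F: "basis3 a b c"
    and A: "coords a b c A (vector [1,0,0])" and B: "coords a b c B (vector [0,1,0])"
    and C: "coords a b c C (vector [0,0,1])" and P': "coords a b c P (vector [1,1,1])"
    using projective_frame[OF triangle P] by blast
  note F' = basis3_rotate[OF F] and F'' = basis3_rotate[OF basis3_rotate[OF F]]
  have AP: "A \<noteq> P" and BP: "B \<noteq> P" and CP: "C \<noteq> P"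
    using P points_in_line by metis+
  obtain v w z where v: "coords a b c A1 v" and w: "coords a b c B1 w" and z: "coords a b c C1 z"
    using coords_exist[OF F] by metis
  have "v$3 = v$2" "w$3 = w$1" "z$2 = z$1"
    using A1 B1 C1 in_line_iff[OF F A P' v AP] in_line_iff[OF F B P' w BP] in_line_iff[OF F C P' z CP]
    by (simp_all add: cross3_simps)
  then obtain x s y t z u where A1': "coords a b c A1 (vector [x,s,s])"
    and B1': "coords a b c B1 (vector [t,y,t])" and C1': "coords a b c C1 (vector [u,u,z])"
    using v w z vector3_eta by metis
  obtain p q r where Q': "coords a b c Q (vector [p,q,r])"
    using coords_exist[OF F, of Q] vector3_eta by metis
  have "B \<noteq> C" "C \<noteq> A" "A \<noteq> B"
    using coords_eq_iff[OF F B C] coords_eq_iff[OF F C A] coords_eq_iff[OF F A B]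
    by (simp_all add: vec3_eq_iff cross_components)
  then have pqr: "p \<noteq> 0" "q \<noteq> 0" "r \<noteq> 0"
    using Q in_line_iff[OF F B C Q'] in_line_iff[OF F C A Q'] in_line_iff[OF F A B Q']
    by (simp_all add: cross3_simps)
  have comm: "line_through X Y = line_through Y X" for X Y
    by (simp add: line_through_def Un_commute)
  note rot = coords_rotate and rot2 = coords_rotate[OF coords_rotate]
  obtain d where Vc: "coords a b c V_C (vector [x * t * q, y * s * p, d])" and nzC: "x * t \<noteq> 0 \<or> y * s \<noteq> 0"
    using crossing_point_coords[OF F A B C A1' B1' Q' Q_lines(1,2) A_Q B_Q V_C_lines V_C V_lines(3)]
    by blast
  \<comment> \<open>In the bases \<open>b, c, a\<close> and \<open>c, a, b\<close> the vertices \<open>A\<close> and \<open>B\<close> play the part of \<open>C\<close>.\<close>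
  obtain e where Va: "coords b c a V_A (vector [y * u * r, z * t * q, e])" and nzA: "y * u \<noteq> 0 \<or> z * t \<noteq> 0"
    using crossing_point_coords[OF F' rot[OF B] rot[OF C] rot[OF A] rot[OF B1'] rot[OF C1'] rot[OF Q']
        Q_lines(2,3) B_Q[unfolded comm[of A C]] C_Q[unfolded comm[of A B]] V_A_lines V_A V_lines(1)]
    by blast
  obtain f where Vb: "coords c a b V_B (vector [z * s * p, x * u * r, f])" and nzB: "z * s \<noteq> 0 \<or> x * u \<noteq> 0"
    using crossing_point_coords[OF F'' rot2[OF C] rot2[OF A] rot2[OF B] rot2[OF C1'] rot2[OF A1'] rot2[OF Q']
        Q_lines(3,1) C_Q A_Q[unfolded comm[of B C]] V_B_lines(2,1)
        V_B[unfolded Int_commute[of "line_through A_Q C1"]] V_lines(2)]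
    by blast
  \<comment> \<open>For nonzero \<open>s\<close>, \<open>t\<close>, \<open>u\<close>, this is \<open>((x/s)/p, (y/t)/q, (z/u)/r)\<close> times \<open>s t u p q r\<close>.\<close>
  define X where "X = (vector [x * t * u * q * r, y * s * u * p * r, z * s * t * p * q] :: real^3)"
  \<comment> \<open>For \<open>u = 0\<close> neither \<open>z t\<close> nor \<open>z s\<close> vanishes, so neither does the third coordinate;
    for \<open>u \<noteq> 0\<close> one of the first two is nonzero.\<close>
  have "X \<noteq> 0"
    using nzA nzB nzC pqr by (auto simp: X_def vec3_eq_iff)
  then obtain Z where Z: "coords a b c Z X" using point_with_coords[OF F] by blast
  have Va': "coords a b c V_A (vector [e, y * u * r, z * t * q])" by (rule rot2[OF Va])
  have Vb': "coords a b c V_B (vector [x * u * r, f, z * s * p])" by (rule rot[OF Vb])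
  show ?thesis
    using in_line_iff[OF F A Va' Z V_lines(1)] in_line_iff[OF F B Vb' Z V_lines(2)]
      in_line_iff[OF F C Vc Z V_lines(3)]
    by (intro exI[of _ Z]) (simp add: X_def cross3_simps)
qed

end
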